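(* For every integer $n\ge 3$ there exists a hypergraph $H$ such that $\tau(H)=3$ and $\overrightarrow{\tau}(H)=n$.
   Context: A hypergraph $H$ consists of a finite vertex set $V(H)$ and a set $E(H)$ of hyperedges, each a nonempty subset of $V(H)$. A set cover of $H$ is a set of vertices intersecting every hyperedge; $\tau(H)$ is the minimum size of a set cover. For a bijection $\sigma: V(H)\to\{1,\dots,|V(H)|\}$ (an ordering), its cost is $\sum_{e\in E(H)}\min_{v\in e}\sigma(v)$. A minimum sum set cover of $H$ is an ordering of minimum cost. For an ordering $\sigma$, let $S_\sigma$ be the set of vertices $v$ with $\sigma(v)\le \max_{e\in E(H)}\min_{u\in e}\sigma(u)$. Define $\overrightarrow{\tau}(H)=\max\{|S_\sigma| : \sigma \text{ a minimum sum set cover of } H\}$. *)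

theory Defs
  imports Main
begin

text \<open>A hypergraph is given by its vertex set \<open>V\<close> and its set of hyperedges \<open>E\<close>.\<close>

definition hypergraph :: "'a set \<Rightarrow> 'a set set \<Rightarrow> bool" where
  "hypergraph V E \<longleftrightarrow> finite V \<and> (\<forall>e\<in>E. e \<subseteq> V \<and> e \<noteq> {})"

definition set_cover :: "'a set \<Rightarrow> 'a set set \<Rightarrow> 'a set \<Rightarrow> bool" where
  "set_cover V E C \<longleftrightarrow> C \<subseteq> V \<and> (\<forall>e\<in>E. C \<inter> e \<noteq> {})"

definition tau :: "'a set \<Rightarrow> 'a set set \<Rightarrow> nat" where
  "tau V E = Min {card C | C. set_cover V E C}"

text \<open>Only the values of an ordering on \<open>V\<close> matter; its values elsewhere are arbitrary.\<close>

definition vertex_ordering :: "'a set \<Rightarrow> ('a \<Rightarrow> nat) \<Rightarrow> bool" where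
  "vertex_ordering V \<sigma> \<longleftrightarrow> bij_betw \<sigma> V {1..card V}"

definition ordering_cost :: "'a set set \<Rightarrow> ('a \<Rightarrow> nat) \<Rightarrow> nat" where
  "ordering_cost E \<sigma> = (\<Sum>e\<in>E. Min (\<sigma> ` e))"

definition min_sum_set_cover :: "'a set \<Rightarrow> 'a set set \<Rightarrow> ('a \<Rightarrow> nat) \<Rightarrow> bool" where
  "min_sum_set_cover V E \<sigma> \<longleftrightarrow>
     vertex_ordering V \<sigma> \<and>
     (\<forall>\<rho>. vertex_ordering V \<rho> \<longrightarrow> ordering_cost E \<sigma> \<le> ordering_cost E \<rho>)"

text \<open>Positions start at 1, so inserting 0 only fixes the maximum to be 0 when there are no
  hyperedges.\<close>

definition covering_prefix :: "'a set \<Rightarrow> 'a set set \<Rightarrow> ('a \<Rightarrow> nat) \<Rightarrow> 'a set" where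
  "covering_prefix V E \<sigma> = {v \<in> V. \<sigma> v \<le> Max (insert 0 {Min (\<sigma> ` e) | e. e \<in> E})}"

definition tau_arrow :: "'a set \<Rightarrow> 'a set set \<Rightarrow> nat" where
  "tau_arrow V E = Max {card (covering_prefix V E \<sigma>) | \<sigma>. min_sum_set_cover V E \<sigma>}"

end

(* Take three "centres" and a set X of n - 3 further vertices; the hyperedges are all sets consisting
   of one centre and an arbitrary subset of X.  The centres are forced, and form a cover.  The cost
   of an ordering is the sum over t of the number of hyperedges missed by the first t vertices,
   which is j * 2^m when j centres and m vertices of X are still to come.  The potential
   2^m * j * (j + 1) / 2 drops by at most this amount at each step exactly because j <= 3, and
   the drop is equal to it if one takes a vertex of X while j = 3.  So listing X first and the
   centres last is optimal; since the centres are themselves singleton hyperedges, this ordering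
   needs all n vertices. *)

theory Submission
  imports Defs
begin

definition join_edges :: "'a set \<Rightarrow> 'a set \<Rightarrow> 'a set set" where
  "join_edges Y X = (\<lambda>(y, S). insert y S) ` (Y \<times> Pow X)"

text \<open>Since \<open>Y\<close> and \<open>X\<close> are disjoint, an edge \<open>e\<close>
  determines its centre through \<open>e \<inter> Y\<close> and its other part as
  \<open>e \<inter> X\<close>.\<close>

lemma inj_on_insert_disjoint:
  assumes "Y \<inter> X = {}"
  shows "inj_on (\<lambda>(y, S). insert y S) (Y \<times> Pow X)"
proof (rule inj_onI, clarsimp)
  fix y S z T
  assume H: "y \<in> Y" "S \<subseteq> X" "z \<in> Y" "T \<subseteq> X" "insert y S = insert z T"
  have "y \<notin> S" "y \<notin> T" "z \<notin> S" "z \<notin> T"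
    using H assms by auto
  with H(5) show "y = z \<and> S = T"
    by (metis insert_ident insert_iff)
qed

text \<open>Used with \<open>U\<close> the set of vertices still to come: the edges missed so far
  again form a family of the same shape, so \<open>card_join_edges\<close> counts them.\<close>

lemma join_edges_subset:
  "{e \<in> join_edges Y X. e \<subseteq> U} = join_edges (Y \<inter> U) (X \<inter> U)"
  unfolding join_edges_def by auto

lemma card_join_edges:
  assumes "finite X" "Y \<inter> X = {}"
  shows "card (join_edges Y X) = card Y * 2 ^ card X"
  unfolding join_edges_def
  using assms by (simp add: card_image inj_on_insert_disjoint card_cartesian_product card_Pow)

lemma finite_join_edges:
  "finite Y \<Longrightarrow> finite X \<Longrightarrow> finite (join_edges Y X)"
  unfolding join_edges_def by simp

lemma singleton_in_join_edges: "y \<in> Y \<Longrightarrow> {y} \<in> join_edges Y X"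
  unfolding join_edges_def by force

lemma hypergraph_join_edges:
  assumes "finite Y" "finite X"
  shows "hypergraph (Y \<union> X) (join_edges Y X)"
  using assms unfolding hypergraph_def join_edges_def by auto

lemma tau_join_edges:
  assumes "finite Y" "finite X"
  shows "tau (Y \<union> X) (join_edges Y X) = card Y"
  unfolding tau_def
proof (rule Min_eqI)
  have "{card C |C. set_cover (Y \<union> X) (join_edges Y X) C} \<subseteq> card ` Pow (Y \<union> X)"
    unfolding set_cover_def by auto
  then show "finite {card C |C. set_cover (Y \<union> X) (join_edges Y X) C}"
    using assms by (meson finite_Pow_iff finite_UnI finite_imageI finite_subset)
next
  fix c assume "c \<in> {card C |C. set_cover (Y \<union> X) (join_edges Y X) C}"
  then obtain C where C: "c = card C" "set_cover (Y \<union> X) (join_edges Y X) C"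
    by auto
  have "Y \<subseteq> C"
    using C(2) singleton_in_join_edges[of _ Y X] unfolding set_cover_def by fastforce
  moreover have "finite C"
    using C(2) assms unfolding set_cover_def by (meson finite_UnI finite_subset)
  ultimately show "card Y \<le> c"
    using C(1) by (simp add: card_mono)
next
  have "set_cover (Y \<union> X) (join_edges Y X) Y"
    unfolding set_cover_def join_edges_def by auto
  then show "card Y \<in> {card C |C. set_cover (Y \<union> X) (join_edges Y X) C}"
    by blast
qed

text \<open>An edge whose first vertex has position p is missed by the first t vertices for exactly
  the p values t = 0, ..., p - 1. Writing p as this count and exchanging the two sums gives the
  formula.\<close>

lemma ordering_cost_eq_sum_uncovered:
  assumes "hypergraph V E" "vertex_ordering V \<sigma>"
  shows "ordering_cost E \<sigma> = (\<Sum>t<card V. card {e \<in> E. e \<subseteq> {v \<in> V. t < \<sigma> v}})"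
proof -
  have finV: "finite V" and sub: "\<And>e. e \<in> E \<Longrightarrow> e \<subseteq> V \<and> e \<noteq> {}"
    using assms(1) unfolding hypergraph_def by auto
  have finE: "finite E"
    using finV sub by (meson PowI finite_Pow_iff finite_subset subsetI)
  have range: "\<sigma> v \<le> card V" if "v \<in> V" for v
    using assms(2) that unfolding vertex_ordering_def bij_betw_def by auto
  have "Min (\<sigma> ` e) = (\<Sum>t<card V. of_bool (e \<subseteq> {v \<in> V. t < \<sigma> v}))" if e: "e \<in> E" for e
  proof -
    have fin: "finite (\<sigma> ` e)" "\<sigma> ` e \<noteq> {}"
      using sub[OF e] finV by (auto intro: finite_subset)
    have "Min (\<sigma> ` e) \<in> \<sigma> ` e"
      using fin by (rule Min_in)
    \<comment> \<open>This bound ensures that cutting the sum off at \<open>card V\<close> loses no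
      t.\<close>
    then have "Min (\<sigma> ` e) \<le> card V"
      using sub[OF e] range by auto
    then have "{..<card V} \<inter> {t. t < Min (\<sigma> ` e)} = {..<Min (\<sigma> ` e)}"
      by (auto simp del: Min_gr_iff)
    moreover have "e \<subseteq> {v \<in> V. t < \<sigma> v} \<longleftrightarrow> t < Min (\<sigma> ` e)" for t
      using fin sub[OF e] by auto
    ultimately show ?thesis
      by (simp add: sum.If_cases of_bool_def del: Min_gr_iff)
  qed
  then have "ordering_cost E \<sigma> = (\<Sum>e\<in>E. \<Sum>t<card V. of_bool (e \<subseteq> {v \<in> V. t < \<sigma> v}))"
    unfolding ordering_cost_def by simp
  also have "\<dots> = (\<Sum>t<card V. \<Sum>e\<in>E. of_bool (e \<subseteq> {v \<in> V. t < \<sigma> v}))"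
    by (rule sum.swap)
  also have "\<dots> = (\<Sum>t<card V. card {e \<in> E. e \<subseteq> {v \<in> V. t < \<sigma> v}})"
    using finE by (simp add: sum.If_cases of_bool_def Int_def)
  finally show ?thesis .
qed

lemma ordering_cost_join_edges:
  assumes "finite Y" "finite X" "Y \<inter> X = {}" "vertex_ordering (Y \<union> X) \<sigma>"
  shows "ordering_cost (join_edges Y X) \<sigma> =
    (\<Sum>t<card (Y \<union> X). card {y \<in> Y. t < \<sigma> y} * 2 ^ card {x \<in> X. t < \<sigma> x})"
proof -
  have "card {e \<in> join_edges Y X. e \<subseteq> {v \<in> Y \<union> X. t < \<sigma> v}} =
      card {y \<in> Y. t < \<sigma> y} * 2 ^ card {x \<in> X. t < \<sigma> x}" for t
  proof -
    have "Y \<inter> {v \<in> Y \<union> X. t < \<sigma> v} = {y \<in> Y. t < \<sigma> y}"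
      and "X \<inter> {v \<in> Y \<union> X. t < \<sigma> v} = {x \<in> X. t < \<sigma> x}"
      by auto
    then show ?thesis
      using assms by (subst join_edges_subset) (auto intro!: card_join_edges)
  qed
  then show ?thesis
    using assms by (simp add: ordering_cost_eq_sum_uncovered[OF hypergraph_join_edges])
qed

text \<open>Twice the potential is used, to avoid division. Taking a centre is tight for every
  number of centres: (j + 1)(j + 2) - j(j + 1) = 2(j + 1).\<close>

lemma potential_step_centre:
  fixes j m :: nat
  shows "2 ^ m * (Suc j * Suc (Suc j)) = 2 * (Suc j * 2 ^ m) + 2 ^ m * (j * Suc j)"
  by (simp add: algebra_simps)

text \<open>Divided by \<open>2 ^ m\<close>, the claim becomes j(j + 1) \<le> 4j, which for natural
  numbers means j \<le> 3. Equality holds at j = 0 and j = 3.\<close>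

lemma potential_step_other:
  fixes j m :: nat
  assumes "j \<le> 3"
  shows "2 ^ Suc m * (j * Suc j) \<le> 2 * (j * 2 ^ Suc m) + 2 ^ m * (j * Suc j)"
proof -
  have "j \<in> {0, 1, 2, 3}"
    using assms by auto
  then show ?thesis
    by auto
qed

text \<open>The step inequalities telescope: twice the cost is at least the drop of the doubled
  potential, from 3 * 4 * \<open>2 ^ card X\<close> at the start to 0 at the end.\<close>

lemma ordering_cost_join_edges_ge:
  assumes "finite Y" "finite X" "Y \<inter> X = {}" "card Y = 3" "vertex_ordering (Y \<union> X) \<sigma>"
  shows "6 * 2 ^ card X \<le> ordering_cost (join_edges Y X) \<sigma>"
proof -
  define n where "n = card (Y \<union> X)"
  define J where "J t = card {y \<in> Y. t < \<sigma> y}" for t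
  define M where "M t = card {x \<in> X. t < \<sigma> x}" for t
  define \<Phi> where "\<Phi> t = 2 ^ M t * (J t * Suc (J t))" for t
  have bij: "bij_betw \<sigma> (Y \<union> X) {1..n}"
    using assms(5) unfolding vertex_ordering_def n_def .
  have step: "\<Phi> t \<le> 2 * (J t * 2 ^ M t) + \<Phi> (Suc t)" if t: "t < n" for t
  proof -
    \<comment> \<open>Passing from t to \<open>Suc t\<close> removes exactly one vertex from those
      still to come, the one at position \<open>Suc t\<close>; the case split is on whether it is a
      centre.\<close>
    have "Suc t \<in> \<sigma> ` (Y \<union> X)"
      using bij t unfolding bij_betw_def by auto
    then obtain v where v: "v \<in> Y \<union> X" "\<sigma> v = Suc t"
      by (metis imageE)
    have uniq: "w = v" if "w \<in> Y \<union> X" "\<sigma> w = Suc t" for w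
      using bij that v unfolding bij_betw_def inj_on_def by metis
    have after: "t < \<sigma> w \<longleftrightarrow> w = v \<or> Suc t < \<sigma> w" if "w \<in> Y \<union> X" for w
      using uniq[OF that] v(2) by auto
    have "J t \<le> 3"
      unfolding J_def using assms(1,4) card_mono[of Y "{y \<in> Y. t < \<sigma> y}"] by auto
    show ?thesis
    proof (cases "v \<in> Y")
      case True
      have "{y \<in> Y. t < \<sigma> y} = insert v {y \<in> Y. Suc t < \<sigma> y}"
        using True after by auto
      then have "J t = Suc (J (Suc t))"
        unfolding J_def using assms(1) v(2) by simp
      moreover have "{x \<in> X. t < \<sigma> x} = {x \<in> X. Suc t < \<sigma> x}"
        using True after assms(3) by auto
      then have "M t = M (Suc t)"
        unfolding M_def by simp
      ultimately show ?thesis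
        unfolding \<Phi>_def by (simp add: potential_step_centre del: mult_Suc mult_Suc_right)
    next
      case False
      have "{x \<in> X. t < \<sigma> x} = insert v {x \<in> X. Suc t < \<sigma> x}"
        using False v(1) after by auto
      then have "M t = Suc (M (Suc t))"
        unfolding M_def using assms(2) v(2) by simp
      moreover have "{y \<in> Y. t < \<sigma> y} = {y \<in> Y. Suc t < \<sigma> y}"
        using False after by auto
      then have "J t = J (Suc t)"
        unfolding J_def by simp
      ultimately show ?thesis
        unfolding \<Phi>_def using potential_step_other[of "J t" "M (Suc t)"] \<open>J t \<le> 3\<close> by simp
    qed
  qed
  have "\<Phi> 0 \<le> 2 * (\<Sum>t<k. J t * 2 ^ M t) + \<Phi> k" if "k \<le> n" for k
    using that
  proof (induction k)
    case (Suc k)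
    then show ?case
      using step[of k] by (simp add: algebra_simps)
  qed simp
  from this[of n] have "\<Phi> 0 \<le> 2 * (\<Sum>t<n. J t * 2 ^ M t) + \<Phi> n"
    by simp
  moreover have "\<sigma> v \<in> {1..n}" if "v \<in> Y \<union> X" for v
    using bij that unfolding bij_betw_def by blast
  then have ends: "{y \<in> Y. 0 < \<sigma> y} = Y" "{x \<in> X. 0 < \<sigma> x} = X" "{y \<in> Y. n < \<sigma> y} = {}"
    by fastforce+
  have "J 0 = 3" "M 0 = card X" "J n = 0"
    unfolding J_def M_def ends using assms(4) by simp_all
  then have "\<Phi> 0 = 12 * 2 ^ card X" "\<Phi> n = 0"
    unfolding \<Phi>_def by simp_all
  ultimately show ?thesis
    unfolding ordering_cost_join_edges[OF assms(1-3,5)] J_def M_def n_def by simp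
qed

text \<open>Here m counts the vertices still to come when the centres are last. The terms up to 3
  give 1 + 2 + 3 = 6, truncated subtraction making the power 1. Each later term, 3 *
  \<open>2 ^ (m - 3)\<close>, equals the sum before it and so doubles the total.\<close>

lemma sum_centres_last:
  assumes "3 \<le> n"
  shows "(\<Sum>m\<in>{1..n}. min 3 m * 2 ^ (m - 3)) = 6 * (2::nat) ^ (n - 3)"
  using assms
proof (induction n rule: dec_induct)
  case base
  then show ?case
    by (simp add: numeral_3_eq_3)
next
  case (step n)
  then have "Suc n - 3 = Suc (n - 3)"
    by simp
  with step show ?case
    by simp
qed

text \<open>Listing the vertices in decreasing order puts the centres 2, 1, 0 last, with 0 at
  position n.\<close>

lemma vertex_ordering_reverse: "vertex_ordering {..<n} (\<lambda>v. n - v)"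
  unfolding vertex_ordering_def
  by (rule bij_betw_byWitness[where f' = "\<lambda>i. n - i"]) auto

lemma ordering_cost_reverse:
  assumes "3 \<le> n"
  shows "ordering_cost (join_edges {..<3} {3..<n}) (\<lambda>v. n - v) = 6 * 2 ^ (n - 3)"
proof -
  have V: "{..<3} \<union> {3..<n} = {..<n}"
    using assms by auto
  \<comment> \<open>After t steps the vertices still to come are those below
    \<open>n - t\<close>.\<close>
  have "{y \<in> {..<3}. t < n - y} = {..<min 3 (n - t)}"
    and "{x \<in> {3..<n}. t < n - x} = {3..<n - t}" for t
    by auto
  then have "ordering_cost (join_edges {..<3} {3..<n}) (\<lambda>v. n - v) =
      (\<Sum>t<n. min 3 (n - t) * 2 ^ (n - t - 3))"
    using ordering_cost_join_edges[of "{..<3}" "{3..<n}" "\<lambda>v. n - v"]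
    by (simp add: V vertex_ordering_reverse ivl_disj_int)
  also have "\<dots> = (\<Sum>m\<in>{1..n}. min 3 m * 2 ^ (m - 3))"
    by (rule sum.reindex_bij_witness[where i = "\<lambda>m. n - m" and j = "\<lambda>t. n - t"]) auto
  finally show ?thesis
    using sum_centres_last[OF assms] by simp
qed

lemma min_sum_set_cover_reverse:
  assumes "3 \<le> n"
  shows "min_sum_set_cover {..<n} (join_edges {..<3} {3..<n}) (\<lambda>v. n - v)"
proof -
  have V: "{..<3} \<union> {3..<n} = {..<n}"
    using assms by auto
  show ?thesis
    unfolding min_sum_set_cover_def ordering_cost_reverse[OF assms]
    using ordering_cost_join_edges_ge[of "{..<3}" "{3..<n}"]
    by (simp add: V vertex_ordering_reverse ivl_disj_int)
qed

text \<open>The edge \<open>{0}\<close> is first met at position n, so the prefix must reach the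
  last vertex.\<close>

lemma covering_prefix_reverse:
  assumes "0 < n" "finite E" "{0} \<in> E"
  shows "covering_prefix {..<n} E (\<lambda>v. n - v) = {..<n}"
proof -
  let ?A = "insert 0 {Min ((\<lambda>v. n - v) ` e) |e. e \<in> E}"
  have "Min ((\<lambda>v. n - v) ` {0}) \<in> ?A"
    using assms(3) by blast
  then have "n \<in> ?A"
    by simp
  moreover have "finite ?A"
    using assms(2) by simp
  ultimately have "n \<le> Max ?A"
    by (rule Max_ge[rotated])
  then show ?thesis
    unfolding covering_prefix_def by auto
qed

text \<open>Every prefix lies in \<open>V\<close>, so one optimal ordering that uses all of
  \<open>V\<close> already attains the maximum.\<close>

lemma tau_arrow_eq_card:
  assumes "finite V" "min_sum_set_cover V E \<sigma>" "covering_prefix V E \<sigma> = V"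
  shows "tau_arrow V E = card V"
  unfolding tau_arrow_def
proof (rule Max_eqI)
  have le: "card (covering_prefix V E \<rho>) \<le> card V" for \<rho>
    using assms(1) unfolding covering_prefix_def by (auto intro: card_mono)
  then show "finite {card (covering_prefix V E \<rho>) |\<rho>. min_sum_set_cover V E \<rho>}"
    by (intro finite_subset[OF _ finite_atMost[of "card V"]] subsetI) auto
  show "\<And>c. c \<in> {card (covering_prefix V E \<rho>) |\<rho>. min_sum_set_cover V E \<rho>} \<Longrightarrow> c \<le> card V"
    using le by auto
  show "card V \<in> {card (covering_prefix V E \<rho>) |\<rho>. min_sum_set_cover V E \<rho>}"
    using assms(2,3) by (intro CollectI exI[of _ \<sigma>]) simp
qed

theorem theorem2:
  fixes n :: nat
  assumes "n \<ge> 3"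
  shows "\<exists>(V :: nat set) (E :: nat set set). hypergraph V E \<and> tau V E = 3 \<and> tau_arrow V E = n"
proof (intro exI conjI)
  let ?E = "join_edges {..<3} {3..<n}"
  have V: "{..<3} \<union> {3..<n} = {..<n}"
    using assms by auto
  show "hypergraph {..<n} ?E"
    using hypergraph_join_edges[of "{..<3}" "{3..<n}"] by (simp add: V)
  show "tau {..<n} ?E = 3"
    using tau_join_edges[of "{..<3}" "{3..<n}"] by (simp add: V)
  have "covering_prefix {..<n} ?E (\<lambda>v. n - v) = {..<n}"
    using assms by (intro covering_prefix_reverse finite_join_edges singleton_in_join_edges) auto
  then show "tau_arrow {..<n} ?E = n"
    using tau_arrow_eq_card[OF _ min_sum_set_cover_reverse[OF assms]] by simp
qed

end
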